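(* Let $r\ge1$ be an integer and $\lambda,\mu,\kappa>0$; put $\theta=\lambda/\mu$, $\gamma=\kappa/\mu$, $$\alpha=\frac{r+\theta+\gamma-\sqrt{(r+\theta+\gamma)^2-4\theta r}}{2r},\qquad C_k=\sum_{l=0}^k\binom{k}{l}\gamma(\gamma+1)\cdots(\gamma+l-1)\theta^{-l}.$$ Let $\pi$ be the stationary distribution of the M/M/$r$ queue with random resetting (see context), and let $P_{\mathrm{delay}}=\sum_{n\ge r}\pi_n$, $L_{\mathrm{queue}}=\sum_{n\ge r}(n-r)\pi_n$, $L_{\mathrm{system}}=\sum_{n\ge0}n\pi_n$, and let $\mathbb{E}[W]$ be the expected waiting time in stationarity. Then $$P_{\mathrm{delay}}=\frac{\alpha}{1-\alpha}\,\pi_{r-1}=\frac{\alpha}{1-\alpha}\cdot\frac{\gamma}{\theta C_r-r\alpha C_{r-1}},\qquad L_{\mathrm{queue}}=\frac{\alpha}{1-\alpha}P_{\mathrm{delay}},$$ $$L_{\mathrm{system}}=L_{\mathrm{queue}}+\frac{\theta}{\gamma+1}+\left[r-\frac{1-\alpha}{\alpha}\left(\frac{\theta(\theta-r\alpha)}{\gamma(\gamma+1)}+\frac{r\theta-r(r-1)\alpha}{\gamma+1}\right)\right]P_{\mathrm{delay}},$$ $$\mathbb{E}[W]=\frac{1}{\lambda}L_{\mathrm{queue}}=\frac{\alpha}{\lambda(1-\alpha)}P_{\mathrm{delay}}.$$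
   Context: The M/M/$r$ queue with random resetting (first-come first-served) is the continuous-time Markov chain on $\mathbb{Z}_+$ with transition mechanisms: $i\to i+1$ at rate $\lambda$ ($i\ge0$, arrival); $i\to i-1$ at rate $\min(i,r)\mu$ ($i\ge1$, departure); $i\to0$ at rate $\kappa$ ($i\ge1$, resetting, clearing all customers); it has a unique stationary distribution $\pi$. The empty product (for $l=0$) equals $1$. $W$ is the time a customer entering the stationary system spends waiting in the queue, i.e. until its service starts or a resetting clears the system. Concretely, the arriving customer finds $n$ customers with probability $\pi_n$; $W=0$ if $n<r$, and if $n\ge r$ then $W=\min(T,R)$ with $T$ a sum of $n-r+1$ independent exponential variables of rate $r\mu$ and $R$ an independent exponential variable of rate $\kappa$. *)

theory Defs
  imports "HOL-Probability.Probability"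
begin

text \<open>
  Continuous-time Markov chains on a discrete state space. Off the diagonal \<^term>\<open>rate i j\<close> is the
  jump rate from \<^term>\<open>i\<close> to \<^term>\<open>j\<close>; diagonal values of \<^term>\<open>rate\<close> are ignored.
\<close>

definition generator :: "('s \<Rightarrow> 's \<Rightarrow> real) \<Rightarrow> 's \<Rightarrow> 's \<Rightarrow> real" where
  "generator rate i j = (if i = j then - (\<Sum>\<^sub>\<infinity>k\<in>- {i}. rate i k) else rate i j)"

text \<open>
  \<^term>\<open>P t i\<close> is the law at time \<^term>\<open>t\<close> of the chain started in \<^term>\<open>i\<close>; only times
  \<^term>\<open>t \<ge> 0\<close> matter. If the total jump rates are bounded, \<^term>\<open>P\<close> is uniquely determined by
  \<^term>\<open>rate\<close>.
\<close>

definition ctmc_with_rates ::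
  "('s \<Rightarrow> 's \<Rightarrow> real) \<Rightarrow> (real \<Rightarrow> 's \<Rightarrow> 's pmf) \<Rightarrow> bool" where
  "ctmc_with_rates rate P \<longleftrightarrow>
     (\<forall>i. P 0 i = return_pmf i) \<and>
     (\<forall>s\<ge>0. \<forall>t\<ge>0. \<forall>i. P (s + t) i = bind_pmf (P s i) (P t)) \<and>
     (\<forall>i j. ((\<lambda>t. pmf (P t i) j) has_real_derivative generator rate i j) (at_right 0))"

definition stationary_distribution :: "(real \<Rightarrow> 's \<Rightarrow> 's pmf) \<Rightarrow> 's pmf \<Rightarrow> bool" where
  "stationary_distribution P \<pi> \<longleftrightarrow> (\<forall>t\<ge>0. bind_pmf \<pi> (P t) = \<pi>)"

text \<open>From state 1, departure and resetting both lead to 0, so their rates add up.\<close>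

definition mmr_reset_rate :: "nat \<Rightarrow> real \<Rightarrow> real \<Rightarrow> real \<Rightarrow> nat \<Rightarrow> nat \<Rightarrow> real" where
  "mmr_reset_rate r lam \<mu> \<kappa> i j =
     (if j = i + 1 then lam else 0) +
     (if i \<ge> 1 \<and> j = i - 1 then real (min i r) * \<mu> else 0) +
     (if i \<ge> 1 \<and> j = 0 then \<kappa> else 0)"

definition mmr_alpha :: "nat \<Rightarrow> real \<Rightarrow> real \<Rightarrow> real" where
  "mmr_alpha r \<theta> \<gamma> =
     (real r + \<theta> + \<gamma> - sqrt ((real r + \<theta> + \<gamma>)^2 - 4 * \<theta> * real r)) / (2 * real r)"

definition mmr_C :: "real \<Rightarrow> real \<Rightarrow> nat \<Rightarrow> real" where
  "mmr_C \<theta> \<gamma> k = (\<Sum>l=0..k. real (k choose l) * pochhammer \<gamma> l * \<theta> powi (- int l))"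

definition P_delay :: "nat \<Rightarrow> nat pmf \<Rightarrow> real" where
  "P_delay r \<pi> = (\<Sum>\<^sub>\<infinity>n\<in>{r..}. pmf \<pi> n)"

definition L_queue :: "nat \<Rightarrow> nat pmf \<Rightarrow> real" where
  "L_queue r \<pi> = (\<Sum>\<^sub>\<infinity>n\<in>{r..}. real (n - r) * pmf \<pi> n)"

definition L_system :: "nat pmf \<Rightarrow> real" where
  "L_system \<pi> = (\<Sum>\<^sub>\<infinity>n. real n * pmf \<pi> n)"

text \<open>
  Waiting time of a customer who finds \<^term>\<open>N \<omega>\<close> customers on arrival, where \<^term>\<open>S k \<omega>\<close>, for
  \<^term>\<open>k = 0\<close>, \<^term>\<open>1\<close>, and so on, are the successive times between service completions while all
  servers are busy, and \<^term>\<open>R \<omega>\<close> is the time until the next resetting.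
\<close>

definition waiting_time ::
  "nat \<Rightarrow> ('w \<Rightarrow> nat) \<Rightarrow> (nat \<Rightarrow> 'w \<Rightarrow> real) \<Rightarrow> ('w \<Rightarrow> real) \<Rightarrow> 'w \<Rightarrow> real" where
  "waiting_time r N S R \<omega> =
     (if N \<omega> < r then 0 else min (\<Sum>k<N \<omega> - r + 1. S k \<omega>) (R \<omega>))"

text \<open>
  \<^term>\<open>N\<close>, \<^term>\<open>R\<close>, \<^term>\<open>S 0\<close>, \<^term>\<open>S 1\<close>, and so on, are mutually independent, with
  \<^term>\<open>N\<close> distributed according to \<^term>\<open>\<pi>\<close>, \<^term>\<open>R\<close> exponential of rate \<^term>\<open>\<kappa>\<close>,
  and each \<^term>\<open>S k\<close> exponential of rate \<^term>\<open>real r * \<mu>\<close>. The family is indexed by the naturals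
  (\<^term>\<open>N\<close> at 0, \<^term>\<open>R\<close> at 1, \<^term>\<open>S k\<close> at \<^term>\<open>k + 2\<close>), with \<^term>\<open>N\<close>
  coerced to the reals.
\<close>

definition arrival_model ::
  "'w measure \<Rightarrow> nat \<Rightarrow> real \<Rightarrow> real \<Rightarrow> nat pmf \<Rightarrow>
   ('w \<Rightarrow> nat) \<Rightarrow> (nat \<Rightarrow> 'w \<Rightarrow> real) \<Rightarrow> ('w \<Rightarrow> real) \<Rightarrow> bool" where
  "arrival_model M r \<mu> \<kappa> \<pi> N S R \<longleftrightarrow>
     prob_space M \<and>
     N \<in> measurable M (count_space UNIV) \<and>
     distr M (count_space UNIV) N = measure_pmf \<pi> \<and>
     (\<forall>k. distributed M lborel (S k) (exponential_density (real r * \<mu>))) \<and>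
     distributed M lborel R (exponential_density \<kappa>) \<and>
     prob_space.indep_vars M (\<lambda>_. borel)
       (case_nat (\<lambda>\<omega>. real (N \<omega>)) (case_nat R S)) UNIV"

end

theory Submission
  imports Defs
begin

text \<open>
  Differentiating stationarity at time \<open>0\<close> gives the global balance equations. Above level \<open>r\<close> they
  form a linear recurrence with characteristic roots \<open>\<alpha> < 1 < \<beta>\<close>, and summability kills the
  \<open>\<beta>\<close>-component, so the tail is geometric with ratio \<open>\<alpha>\<close>. Below level \<open>r\<close> the sequence
  \<open>\<theta>\<^sup>k C\<^sub>k / k!\<close> solves the homogeneous recurrence, and its Casoratian with \<open>\<pi>\<close>, which is explicit,
  determines \<open>\<pi>\<close> at \<open>r - 1\<close>. The mean comes from weighting the balance equation of state \<open>j\<close>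
  with \<open>j\<close>. For the waiting time, \<open>E[min T R] = (1 - E[exp (- \<kappa> T)]) / \<kappa>\<close> reduces everything
  to Laplace transforms of exponential variables.
\<close>

section \<open>Stationary distributions and the balance equations\<close>

lemma pmf_nat_sums: "pmf p sums 1" for p :: "nat pmf"
proof -
  have "(\<lambda>n. measure (measure_pmf p) {n}) sums measure (measure_pmf p) (\<Union>n. {n})"
    by (rule measure_pmf.finite_measure_UNION) (auto simp: disjoint_family_on_def)
  moreover have "(\<Union>n. {n}) = (UNIV :: nat set)" by auto
  ultimately show ?thesis by (simp add: measure_pmf_single)
qed

text \<open>The return probability is supermultiplicative in time. Cutting \<open>t\<close> into
  \<open>n\<close> steps so short that the derivative at 0 controls each of them, Bernoulli's
  inequality turns the resulting product into a bound linear in \<open>t\<close>.\<close>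

lemma ctmc_return_probability_lower_bound:
  assumes ctmc: "ctmc_with_rates rate P"
    and c: "- generator rate i i < c" and t: "t \<ge> 0"
  shows "1 - c * t \<le> pmf (P t i) i"
proof -
  have P0: "P 0 i = return_pmf i" and
    semigroup: "\<And>s t. s \<ge> 0 \<Longrightarrow> t \<ge> 0 \<Longrightarrow> P (s + t) i = bind_pmf (P s i) (P t)" and
    deriv: "((\<lambda>t. pmf (P t i) i) has_real_derivative generator rate i i) (at_right 0)"
    using ctmc unfolding ctmc_with_rates_def by auto
  have supermult: "pmf (P s i) i * pmf (P u i) i \<le> pmf (P (s + u) i) i"
    if "s \<ge> 0" "u \<ge> 0" for s u
  proof -
    \<comment> \<open>Chapman-Kolmogorov, keeping only the intermediate state
      \<open>i\<close>.\<close>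
    have "pmf (P s i) i * pmf (P u i) i = (\<integral>x. indicator {i} x * pmf (P u i) i \<partial>measure_pmf (P s i))"
      by (simp add: measure_pmf_single)
    also have "\<dots> \<le> (\<integral>x. pmf (P u x) i \<partial>measure_pmf (P s i))"
      by (intro integral_mono measure_pmf.integrable_const_bound[where B=1])
         (auto simp: pmf_le_1 indicator_def)
    also have "\<dots> = pmf (P (s + u) i) i"
      using semigroup[OF that] by (simp add: pmf_bind)
    finally show ?thesis .
  qed
  have power: "pmf (P u i) i ^ n \<le> pmf (P (real n * u) i) i" if "u \<ge> 0" for u n
  proof (induction n)
    case (Suc n)
    have "pmf (P u i) i ^ Suc n \<le> pmf (P u i) i * pmf (P (real n * u) i) i"
      using Suc by (simp add: mult_left_mono)
    also have "\<dots> \<le> pmf (P (u + real n * u) i) i"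
      using that by (intro supermult) auto
    finally show ?case by (simp add: algebra_simps)
  qed (simp add: P0)
  have "((\<lambda>h. (pmf (P h i) i - 1) / h) \<longlongrightarrow> generator rate i i) (at_right 0)"
    using deriv by (simp add: has_field_derivative_iff P0)
  then have "\<forall>\<^sub>F h in at_right 0. - c < (pmf (P h i) i - 1) / h"
    using c by (intro order_tendstoD(1)) auto
  then obtain \<delta> where \<delta>: "\<delta> > 0"
    and small: "\<And>h. 0 < h \<Longrightarrow> h < \<delta> \<Longrightarrow> - c < (pmf (P h i) i - 1) / h"
    unfolding eventually_at_right_field by auto
  show ?thesis
  \<comment> \<open>For \<open>c * t \<ge> 1\<close> the left side is not positive. Otherwise every
    step satisfies \<open>c * h \<le> 1\<close>, which Bernoulli's inequality needs.\<close>
  proof (cases "t = 0 \<or> c * t \<ge> 1")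
    case True
    then show ?thesis
      using pmf_nonneg[of "P t i" i] by (auto simp: P0 simp del: pmf_nonneg)
  next
    case False
    then have t0: "t > 0" and ct: "c * t < 1" using t by auto
    obtain n where n: "real n > t / \<delta>" using reals_Archimedean2 by blast
    have n0: "real n > 0" using n t0 \<delta> by (smt (verit) divide_pos_pos)
    define h where "h = t / real n"
    have h: "0 < h" "h < \<delta>" "real n * h = t"
      using n n0 t0 \<delta> by (auto simp: h_def field_simps)
    have step: "1 - c * h \<le> pmf (P h i) i"
      using small[OF h(1,2)] h(1) by (simp add: field_simps)
    have ch: "c * h \<le> 1"
    proof (cases "c \<ge> 0")
      case True
      have "1 \<le> real n" using n0 by simp
      then have "h \<le> t" using t0 by (simp add: h_def field_simps)
      then have "c * h \<le> c * t" using True by (simp add: mult_left_mono)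
      then show ?thesis using ct by simp
    next
      case False
      then show ?thesis using h(1) by (smt (verit) mult_nonpos_nonneg)
    qed
    have "1 - c * t = 1 + real n * (- (c * h))"
      using h(3) by (simp add: algebra_simps)
    also have "\<dots> \<le> (1 + (- (c * h))) ^ n"
      by (rule Bernoulli_inequality) (use ch in auto)
    also have "\<dots> \<le> pmf (P h i) i ^ n"
      using step ch by (intro power_mono) auto
    also have "\<dots> \<le> pmf (P t i) i"
      using power[of h n] h by simp
    finally show ?thesis .
  qed
qed

text \<open>The return bound dominates the difference quotients by \<open>c\<close>, uniformly in
  the starting state. Dominated convergence then differentiates the marginal probability of
  \<open>j\<close>, which stationarity keeps constant.\<close>

lemma stationary_distribution_generator_eq_0:
  assumes ctmc: "ctmc_with_rates rate P" and stat: "stationary_distribution P \<pi>"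
    and bounded: "\<And>i. - generator rate i i < c"
  shows "measure_pmf.expectation \<pi> (\<lambda>i. generator rate i j) = 0"
proof -
  define t where "t n = 1 / real (Suc n)" for n
  define D where "D n i = (pmf (P (t n) i) j - pmf (P 0 i) j) / t n" for n i
  have t_pos: "t n > 0" for n by (simp add: t_def)
  have P0: "P 0 i = return_pmf i" for i
    using ctmc unfolding ctmc_with_rates_def by auto
  have t_lim: "filterlim t (at_right 0) sequentially"
    unfolding filterlim_at
    using LIMSEQ_Suc[OF lim_inverse_n'] t_pos by (auto simp: t_def[abs_def])
  have bound: "norm (D n i) \<le> c" for n i
  proof -
    \<comment> \<open>For \<open>j \<noteq> i\<close>, the mass at \<open>j\<close> is part of the
      mass that has left \<open>i\<close>.\<close>
    have "\<bar>pmf (P (t n) i) j - pmf (P 0 i) j\<bar> \<le> 1 - pmf (P (t n) i) i"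
    proof (cases "i = j")
      case False
      have "pmf (P (t n) i) i + pmf (P (t n) i) j = (\<Sum>k\<in>{i, j}. pmf (P (t n) i) k)"
        using False by simp
      also have "\<dots> \<le> 1"
        by (subst measure_measure_pmf_finite[symmetric]) auto
      finally show ?thesis using False by (simp add: P0)
    qed (simp add: P0 pmf_le_1)
    also have "\<dots> \<le> c * t n"
      using ctmc_return_probability_lower_bound[OF ctmc bounded, of "t n" i] t_pos[of n] by simp
    finally show ?thesis
      using t_pos[of n] by (simp add: D_def abs_divide field_simps)
  qed
  have "(\<lambda>n. measure_pmf.expectation \<pi> (D n)) \<longlonglongrightarrow>
      measure_pmf.expectation \<pi> (\<lambda>i. generator rate i j)"
  proof (rule integral_dominated_convergence[where w="\<lambda>_. c"])
    have "((\<lambda>h. (pmf (P h i) j - pmf (P 0 i) j) / h) \<longlongrightarrow> generator rate i j) (at_right 0)" for i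
      using ctmc unfolding ctmc_with_rates_def has_field_derivative_iff diff_zero by blast
    then have "(\<lambda>n. D n i) \<longlonglongrightarrow> generator rate i j" for i
      unfolding D_def by (rule filterlim_compose[OF _ t_lim])
    then show "AE i in measure_pmf \<pi>. (\<lambda>n. D n i) \<longlonglongrightarrow> generator rate i j" by simp
  qed (use bound in auto)
  moreover have "measure_pmf.expectation \<pi> (D n) = 0" for n
  proof -
    have marginal: "measure_pmf.expectation \<pi> (\<lambda>i. pmf (P s i) j) = pmf \<pi> j" if "s \<ge> 0" for s
      using stat that pmf_bind[of \<pi> "P s" j] unfolding stationary_distribution_def by metis
    have "integrable (measure_pmf \<pi>) (\<lambda>i. pmf (P s i) j)" for s
      by (intro measure_pmf.integrable_const_bound[where B=1]) (auto simp: pmf_le_1)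
    then show ?thesis
      unfolding D_def using marginal t_pos[of n] by simp
  qed
  ultimately show ?thesis
    by (simp add: LIMSEQ_const_iff)
qed

section \<open>Jump rates and balance equations of the resetting queue\<close>

lemma generator_mmr_reset_diag:
  "generator (mmr_reset_rate r lam \<mu> \<kappa>) i i =
    - (lam + real (min i r) * \<mu> + (if i \<ge> 1 then \<kappa> else 0))"
proof -
  let ?rate = "mmr_reset_rate r lam \<mu> \<kappa>"
  have "(\<Sum>\<^sub>\<infinity>k\<in>- {i}. ?rate i k) = (\<Sum>\<^sub>\<infinity>k\<in>{..Suc i} - {i}. ?rate i k)"
    by (rule infsum_cong_neutral) (auto simp: mmr_reset_rate_def)
  also have "\<dots> = (\<Sum>k\<in>{..Suc i} - {i}. ?rate i k)" by simp
  also have "\<dots> = lam + real (min i r) * \<mu> + (if i \<ge> 1 then \<kappa> else 0)"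
  proof (cases i)
    case 0
    then show ?thesis by (simp add: mmr_reset_rate_def)
  next
    case (Suc m)
    \<comment> \<open>For \<open>m = 0\<close> the last two targets coincide and their indicators
      add up, so state 1 needs no separate case.\<close>
    have "?rate i k = (if k = Suc (Suc m) then lam else 0) +
        (if k = m then real (min i r) * \<mu> else 0) + (if k = 0 then \<kappa> else 0)" for k
      using Suc by (simp add: mmr_reset_rate_def)
    then show ?thesis
      using Suc by (simp add: sum.distrib)
  qed
  finally show ?thesis by (simp add: generator_def)
qed

lemma mmr_reset_generator_expectation:
  assumes ctmc: "ctmc_with_rates (mmr_reset_rate r lam \<mu> \<kappa>) P"
    and stat: "stationary_distribution P \<pi>"
    and pos: "\<mu> > 0" "\<kappa> > 0"
  shows "measure_pmf.expectation \<pi> (\<lambda>i. generator (mmr_reset_rate r lam \<mu> \<kappa>) i j) = 0"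
proof (rule stationary_distribution_generator_eq_0[OF ctmc stat])
  fix i
  have "real (min i r) * \<mu> \<le> real r * \<mu>"
    using pos by (intro mult_right_mono) auto
  then show "- generator (mmr_reset_rate r lam \<mu> \<kappa>) i i < lam + real r * \<mu> + \<kappa> + 1"
    unfolding generator_mmr_reset_diag using pos by (smt (verit))
qed

text \<open>Every state but 0 resets to 0, so column 0 of the generator has infinite support.
  Subtracting the constant \<kappa> leaves \<open>g\<close>, supported on \<open>{0, 1}\<close>; the
  constant integrates to the inhomogeneous term.\<close>

lemma mmr_reset_balance_0:
  assumes ctmc: "ctmc_with_rates (mmr_reset_rate r lam \<mu> \<kappa>) P"
    and stat: "stationary_distribution P \<pi>"
    and pos: "\<mu> > 0" "\<kappa> > 0" and r: "r \<ge> 1"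
  shows "(lam + \<kappa>) * pmf \<pi> 0 = \<mu> * pmf \<pi> 1 + \<kappa>"
proof -
  let ?q = "\<lambda>i. generator (mmr_reset_rate r lam \<mu> \<kappa>) i 0"
  define g where "g i = (if i = 0 then - (lam + \<kappa>) else if i = 1 then \<mu> else 0)" for i :: nat
  have q: "?q i = g i + \<kappa>" for i
  proof (cases "i = 0")
    case True
    then show ?thesis by (simp add: generator_mmr_reset_diag g_def)
  next
    case False
    then show ?thesis using r by (auto simp: generator_def mmr_reset_rate_def g_def)
  qed
  have "measure_pmf.expectation \<pi> g = (\<Sum>i\<in>{0, 1}. g i * pmf \<pi> i)"
    by (rule integral_measure_pmf_real) (auto simp: g_def split: if_splits)
  moreover have "integrable (measure_pmf \<pi>) g"
    by (rule measure_pmf.integrable_const_bound[where B="\<bar>lam + \<kappa>\<bar> + \<bar>\<mu>\<bar>"]) (auto simp: g_def)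
  ultimately have "measure_pmf.expectation \<pi> ?q = (\<Sum>i\<in>{0, 1}. g i * pmf \<pi> i) + \<kappa>"
    by (simp add: q)
  then show ?thesis
    using mmr_reset_generator_expectation[OF ctmc stat pos, of 0] by (simp add: g_def algebra_simps)
qed

text \<open>Resetting only enters state 0, so this column of the generator has at most three nonzero
  entries and the expectation is a finite sum.\<close>

lemma mmr_reset_balance_Suc:
  assumes ctmc: "ctmc_with_rates (mmr_reset_rate r lam \<mu> \<kappa>) P"
    and stat: "stationary_distribution P \<pi>"
    and pos: "\<mu> > 0" "\<kappa> > 0"
  shows "(lam + real (min (Suc k) r) * \<mu> + \<kappa>) * pmf \<pi> (Suc k) =
    lam * pmf \<pi> k + real (min (Suc (Suc k)) r) * \<mu> * pmf \<pi> (Suc (Suc k))"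
proof -
  let ?q = "\<lambda>i. generator (mmr_reset_rate r lam \<mu> \<kappa>) i (Suc k)"
  have "measure_pmf.expectation \<pi> ?q = (\<Sum>i\<in>{k, Suc k, Suc (Suc k)}. ?q i * pmf \<pi> i)"
    by (rule integral_measure_pmf_real)
       (auto simp: generator_def mmr_reset_rate_def split: if_splits)
  also have "\<dots> = lam * pmf \<pi> k + ?q (Suc k) * pmf \<pi> (Suc k) +
      real (min (Suc (Suc k)) r) * \<mu> * pmf \<pi> (Suc (Suc k))"
    by (auto simp: generator_def[of _ k] generator_def[of _ "Suc (Suc k)"] mmr_reset_rate_def)
  also have "?q (Suc k) = - (lam + real (min (Suc k) r) * \<mu> + \<kappa>)"
    by (simp add: generator_mmr_reset_diag)
  finally show ?thesis
    using mmr_reset_generator_expectation[OF ctmc stat pos, of "Suc k"] by (simp add: algebra_simps)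
qed

section \<open>Solution of the balance equations\<close>

text \<open>This is the balance recurrence below level \<open>r\<close> for
  \<open>\<theta> ^ k * mmr_C \<theta> \<gamma> k / fact k\<close>. Pascal's rule and
  \<open>c_Suc\<close> leave a sum weighted by \<open>l\<close>, which absorption resolves. For
  \<open>k = 0\<close> the truncated index \<open>k - 1\<close> has the factor 0.\<close>

lemma mmr_C_recurrence:
  assumes "\<theta> \<noteq> 0"
  shows "\<theta> * mmr_C \<theta> \<gamma> (Suc k) = (\<theta> + real k + \<gamma>) * mmr_C \<theta> \<gamma> k - real k * mmr_C \<theta> \<gamma> (k - 1)"
proof -
  define c where "c l = pochhammer \<gamma> l / \<theta> ^ l" for l
  \<comment> \<open>A range that may exceed \<open>k\<close> lets sums for neighbouring
    \<open>k\<close> share an index set.\<close>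
  have C: "mmr_C \<theta> \<gamma> k = (\<Sum>l\<le>m. real (k choose l) * c l)" if "k \<le> m" for k m
  proof -
    have "mmr_C \<theta> \<gamma> k = (\<Sum>l\<le>k. real (k choose l) * c l)"
      by (simp add: mmr_C_def c_def atLeast0AtMost power_int_minus divide_inverse mult.assoc)
    also have "\<dots> = (\<Sum>l\<le>m. real (k choose l) * c l)"
      by (rule sum.mono_neutral_left) (use that in auto)
    finally show ?thesis .
  qed
  have c_Suc: "\<theta> * c (Suc l) = (\<gamma> + real l) * c l" for l
    using assms by (simp add: c_def pochhammer_Suc field_simps)
  have "mmr_C \<theta> \<gamma> (Suc k) = c 0 + (\<Sum>l\<le>k. real (Suc k choose Suc l) * c (Suc l))"
    using C[of "Suc k" "Suc k"] by (simp add: sum.atMost_Suc_shift del: sum.atMost_Suc binomial_Suc_Suc)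
  also have "\<dots> = (c 0 + (\<Sum>l\<le>k. real (k choose Suc l) * c (Suc l))) +
      (\<Sum>l\<le>k. real (k choose l) * c (Suc l))"
    by (simp add: sum.distrib algebra_simps)
  also have "c 0 + (\<Sum>l\<le>k. real (k choose Suc l) * c (Suc l)) = mmr_C \<theta> \<gamma> k"
    using C[of k "Suc k"] by (simp add: sum.atMost_Suc_shift del: sum.atMost_Suc)
  finally have "\<theta> * mmr_C \<theta> \<gamma> (Suc k) =
      \<theta> * mmr_C \<theta> \<gamma> k + (\<Sum>l\<le>k. real (k choose l) * (\<theta> * c (Suc l)))"
    by (simp add: algebra_simps sum_distrib_left)
  also have "(\<Sum>l\<le>k. real (k choose l) * (\<theta> * c (Suc l))) =
      \<gamma> * mmr_C \<theta> \<gamma> k + (\<Sum>l\<le>k. real l * real (k choose l) * c l)"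
    by (simp add: c_Suc C[of k k] algebra_simps sum.distrib sum_distrib_left)
  also have "(\<Sum>l\<le>k. real l * real (k choose l) * c l) =
      real k * mmr_C \<theta> \<gamma> k - real k * mmr_C \<theta> \<gamma> (k - 1)"
  proof (cases k)
    case (Suc m)
    \<comment> \<open>Absorption gives \<open>k * (m choose (l - 1))\<close>, and Pascal's rule
      turns that into a difference.\<close>
    have absorb: "real l * real (k choose l) = real k * (real (k choose l) - real (m choose l))" for l
    proof (cases l)
      case (Suc i)
      have "real (Suc i * (Suc m choose Suc i)) = real (Suc m * (m choose i))"
        using Suc_times_binomial[of i m] by presburger
      then show ?thesis
        using \<open>k = Suc m\<close> Suc by (simp add: algebra_simps)
    qed (simp)
    have "(\<Sum>l\<le>k. real l * real (k choose l) * c l) =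
        (\<Sum>l\<le>k. real k * (real (k choose l) * c l) - real k * (real (m choose l) * c l))"
      by (simp only: absorb) (simp add: algebra_simps)
    also have "\<dots> = real k * mmr_C \<theta> \<gamma> k - real k * mmr_C \<theta> \<gamma> m"
      using Suc by (simp add: sum_subtractf sum_distrib_left[symmetric] C[of "Suc m" "Suc m"] C[of m "Suc m"] del: sum.atMost_Suc)
    finally show ?thesis using Suc by simp
  qed simp
  finally show ?thesis by (simp add: algebra_simps)
qed

text \<open>Passes from \<open>sums\<close> to the unordered summation in \<open>P_delay\<close> and
  \<open>L_queue\<close>; nonnegativity makes the convergence unconditional.\<close>

lemma has_sum_atLeast:
  fixes f :: "nat \<Rightarrow> real" and r :: nat
  assumes f: "\<And>k. f k \<ge> 0" and sums: "(\<lambda>k. f (r + k)) sums s"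
  shows "(f has_sum s) {r..}"
proof -
  have "((\<lambda>k. f (r + k)) has_sum s) UNIV"
    by (rule sums_nonneg_imp_has_sum[OF sums f])
  moreover have "bij_betw (\<lambda>k. r + k) UNIV {r..}"
    by (rule bij_betwI[where g="\<lambda>n. n - r"]) auto
  ultimately show ?thesis
    using has_sum_reindex_bij_betw[of "\<lambda>k. r + k" UNIV "{r..}" f s] by simp
qed

text \<open>The balance equations divided by \<mu>, detached from the chain. In
  \<open>balance_0\<close> the inflow by resetting, \<open>\<gamma> * (1 - p 0)\<close>, is already
  expressed through the total mass 1.\<close>

locale mmr_reset_balance =
  fixes r :: nat and \<theta> \<gamma> :: real and p :: "nat \<Rightarrow> real"
  assumes r_ge_1: "r \<ge> 1" and \<theta>_pos: "\<theta> > 0" and \<gamma>_pos: "\<gamma> > 0"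
    and p_nonneg: "p n \<ge> 0" and p_sums: "p sums 1"
    and balance_0: "(\<theta> + \<gamma>) * p 0 = p 1 + \<gamma>"
    and balance_Suc: "(\<theta> + real (min (Suc k) r) + \<gamma>) * p (Suc k) =
      \<theta> * p k + real (min (Suc (Suc k)) r) * p (Suc (Suc k))"
begin

section \<open>Characteristic roots of the recurrence above level r\<close>

definition \<alpha> :: real where "\<alpha> = mmr_alpha r \<theta> \<gamma>"

text \<open>The larger root of \<open>r * x ^ 2 - (r + \<theta> + \<gamma>) * x + \<theta>\<close>,
  whose smaller root is \<open>\<alpha>\<close>.\<close>

definition \<beta> :: real where
  "\<beta> = (real r + \<theta> + \<gamma> + sqrt ((real r + \<theta> + \<gamma>)\<^sup>2 - 4 * \<theta> * real r)) / (2 * real r)"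

lemma r_pos: "real r > 0"
  using r_ge_1 by simp

lemma discriminant_nonneg: "(real r + \<theta> + \<gamma>)\<^sup>2 - 4 * \<theta> * real r \<ge> 0"
proof -
  have "(real r + \<theta> + \<gamma>)\<^sup>2 - 4 * \<theta> * real r =
      (real r - \<theta>)\<^sup>2 + \<gamma> * (\<gamma> + 2 * real r + 2 * \<theta>)"
    by (simp add: power2_eq_square algebra_simps)
  also have "\<dots> \<ge> 0"
    using \<gamma>_pos \<theta>_pos by simp
  finally show ?thesis .
qed

text \<open>Vieta's formulas. Apart from the comparison \<open>\<alpha> \<le> \<beta>\<close>, the
  roots enter later arguments through these and not through the square root.\<close>

lemma roots: "real r * (\<alpha> + \<beta>) = real r + \<theta> + \<gamma>" "real r * (\<alpha> * \<beta>) = \<theta>"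
proof -
  define b where "b = real r + \<theta> + \<gamma>"
  define s where "s = sqrt (b\<^sup>2 - 4 * \<theta> * real r)"
  have sq: "s\<^sup>2 = b\<^sup>2 - 4 * \<theta> * real r"
    unfolding s_def b_def by (rule real_sqrt_pow2[OF discriminant_nonneg])
  have \<alpha>: "\<alpha> = (b - s) / (2 * real r)" and \<beta>: "\<beta> = (b + s) / (2 * real r)"
    by (simp_all add: \<alpha>_def mmr_alpha_def \<beta>_def b_def s_def)
  show "real r * (\<alpha> + \<beta>) = real r + \<theta> + \<gamma>"
    unfolding \<alpha> \<beta> using r_pos by (simp add: field_simps b_def)
  have "4 * (real r * real r) * (\<alpha> * \<beta>) = (b - s) * (b + s)"
    unfolding \<alpha> \<beta> using r_pos by simp
  also have "\<dots> = 4 * \<theta> * real r"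
    using sq by (simp add: power2_eq_square algebra_simps)
  finally show "real r * (\<alpha> * \<beta>) = \<theta>"
    using r_pos by simp
qed

text \<open>The root equation, arranged so that \<open>\<theta> - real r * \<alpha> = \<gamma> *
  \<alpha> / (1 - \<alpha>)\<close> can be read off.\<close>

lemma \<alpha>_quadratic: "\<gamma> * \<alpha> = (1 - \<alpha>) * (\<theta> - real r * \<alpha>)"
proof -
  have "\<theta> - (real r + \<theta> + \<gamma>) * \<alpha> + real r * \<alpha> * \<alpha> =
      real r * (\<alpha> * \<beta>) - (real r * (\<alpha> + \<beta>)) * \<alpha> + real r * \<alpha> * \<alpha>"
    by (simp only: roots)
  also have "\<dots> = 0"
    by (simp add: algebra_simps)
  finally have "\<theta> - (real r + \<theta> + \<gamma>) * \<alpha> + real r * \<alpha> * \<alpha> = 0" .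
  then show ?thesis by (simp add: algebra_simps)
qed

text \<open>The quadratic polynomial has the negative value \<open>- \<gamma>\<close> at 1, so 1
  lies strictly between the roots; their product is positive.\<close>

lemma \<alpha>_bounds: "0 < \<alpha>" "\<alpha> < 1" and \<beta>_gt_1: "1 < \<beta>"
proof -
  have "\<alpha> \<le> \<beta>"
    using discriminant_nonneg r_pos
    by (simp add: \<alpha>_def mmr_alpha_def \<beta>_def divide_right_mono)
  have "real r * ((1 - \<alpha>) * (1 - \<beta>)) = real r - real r * (\<alpha> + \<beta>) + real r * (\<alpha> * \<beta>)"
    by (simp add: algebra_simps)
  then have "real r * ((1 - \<alpha>) * (1 - \<beta>)) = - \<gamma>"
    unfolding roots by simp
  then have neg: "(1 - \<alpha>) * (1 - \<beta>) < 0"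
    using r_pos \<gamma>_pos by (smt (verit) mult_nonneg_nonneg)
  then show "\<alpha> < 1" and "1 < \<beta>"
    using \<open>\<alpha> \<le> \<beta>\<close> by (auto simp: mult_less_0_iff)
  have "\<alpha> * \<beta> > 0"
    using roots(2) r_pos \<theta>_pos by (metis zero_less_mult_pos)
  then show "0 < \<alpha>"
    using \<open>1 < \<beta>\<close> by (intro zero_less_mult_pos2[of \<alpha> \<beta>]) auto
qed

section \<open>Geometric tail and the value at level r - 1\<close>

lemma p_tendsto_0: "p \<longlonglongrightarrow> 0"
  by (rule summable_LIMSEQ_zero[OF sums_summable[OF p_sums]])

lemma balance_above:
  assumes "k \<ge> r"
  shows "p (Suc k) = (\<alpha> + \<beta>) * p k - \<alpha> * \<beta> * p (k - 1)"
proof -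
  obtain j where k: "k = Suc j" using assms r_ge_1 by (cases k) auto
  have "(\<theta> + real r + \<gamma>) * p k = \<theta> * p j + real r * p (Suc k)"
    using balance_Suc[of j] assms k by (simp add: min_absorb2)
  moreover have "real r * ((\<alpha> + \<beta>) * p k - \<alpha> * \<beta> * p j) =
      (real r * (\<alpha> + \<beta>)) * p k - (real r * (\<alpha> * \<beta>)) * p j"
    by (simp add: algebra_simps)
  ultimately have "real r * p (Suc k) = real r * ((\<alpha> + \<beta>) * p k - \<alpha> * \<beta> * p j)"
    unfolding roots by (simp add: algebra_simps)
  then show ?thesis using r_pos k by simp
qed

lemma p_step: "p r = \<alpha> * p (r - 1)"
proof -
  \<comment> \<open>\<open>d\<close> removes the \<open>\<alpha>\<close>-component, so each step
    multiplies it by \<open>\<beta> > 1\<close>; tending to 0, it must vanish from the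
    start.\<close>
  define d where "d n = p (n + r) - \<alpha> * p (n + r - 1)" for n
  have d_Suc: "d (Suc n) = \<beta> * d n" for n
    using balance_above[of "n + r"] by (simp add: d_def algebra_simps)
  have d: "d n = \<beta> ^ n * d 0" for n
    by (induction n) (simp_all add: d_Suc)
  have "d \<longlonglongrightarrow> 0 - \<alpha> * 0"
  proof -
    have "(\<lambda>n. p (n + (r - 1))) \<longlonglongrightarrow> 0" "(\<lambda>n. p (n + r)) \<longlonglongrightarrow> 0"
      by (rule LIMSEQ_ignore_initial_segment[OF p_tendsto_0])+
    then show ?thesis
      unfolding d_def using r_ge_1 by (intro tendsto_intros) simp_all
  qed
  then have "(\<lambda>n. \<bar>d n\<bar>) \<longlonglongrightarrow> 0"
    using tendsto_rabs_zero by simp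
  moreover have "\<bar>d 0\<bar> \<le> \<bar>d n\<bar>" for n
    unfolding d[of n] abs_mult using \<beta>_gt_1 mult_right_mono[OF one_le_power[of \<beta> n], of "\<bar>d 0\<bar>"]
    by simp
  ultimately have "\<bar>d 0\<bar> \<le> 0"
    using LIMSEQ_le_const[of "\<lambda>n. \<bar>d n\<bar>" 0 "\<bar>d 0\<bar>"] by blast
  then show ?thesis by (simp add: d_def)
qed

lemma p_geometric: "p (r + k) = \<alpha> ^ Suc k * p (r - 1)"
proof (induction k rule: less_induct)
  case (less k)
  show ?case
  proof (cases k)
    case 0
    then show ?thesis by (simp add: p_step)
  next
    case (Suc j)
    \<comment> \<open>The recurrence has order two; for \<open>j = 0\<close> the earlier term sits
      at level \<open>r - 1\<close>, outside the induction hypothesis.\<close>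
    have prev: "p (r + j - 1) = \<alpha> ^ j * p (r - 1)"
      using less[of "j - 1"] Suc by (cases j) auto
    have "p (r + k) = (\<alpha> + \<beta>) * (\<alpha> ^ Suc j * p (r - 1)) - \<alpha> * \<beta> * (\<alpha> ^ j * p (r - 1))"
      using balance_above[of "r + j"] less[of j] prev Suc by simp
    then show ?thesis using Suc by (simp add: algebra_simps)
  qed
qed

text \<open>The Casoratian of \<open>p\<close> and the homogeneous solution, rescaled to be constant
  for \<open>k < r\<close>: the recurrences cancel in the induction step, and
  \<open>balance_0\<close> gives the value \<gamma>. At \<open>k = r - 1\<close>,
  \<open>p_step\<close> eliminates \<open>p r\<close>.\<close>

lemma p_r_minus_1:
  "p (r - 1) * (\<theta> * mmr_C \<theta> \<gamma> r - real r * \<alpha> * mmr_C \<theta> \<gamma> (r - 1)) = \<gamma>"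
proof -
  let ?C = "mmr_C \<theta> \<gamma>"
  have "\<theta> * p k * ?C (Suc k) - real (Suc k) * p (Suc k) * ?C k = \<gamma>" if "k < r" for k
    using that
  proof (induction k)
    case 0
    have "?C 0 = 1" "\<theta> * ?C 1 = \<theta> + \<gamma>"
      using mmr_C_recurrence[of \<theta> \<gamma> 0] \<theta>_pos by (simp_all add: mmr_C_def)
    moreover have "\<theta> * p 0 * ?C 1 = (\<theta> * ?C 1) * p 0" by simp
    ultimately show ?case
      using balance_0 by simp
  next
    case (Suc k)
    have "(\<theta> + real (Suc k) + \<gamma>) * p (Suc k) = \<theta> * p k + real (Suc (Suc k)) * p (Suc (Suc k))"
      using balance_Suc[of k] Suc.prems by (simp add: min_absorb1)
    then have "real (Suc (Suc k)) * p (Suc (Suc k)) * ?C (Suc k) =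
        ((\<theta> + real (Suc k) + \<gamma>) * p (Suc k) - \<theta> * p k) * ?C (Suc k)"
      by simp
    moreover have "\<theta> * p (Suc k) * ?C (Suc (Suc k)) =
        p (Suc k) * ((\<theta> + real (Suc k) + \<gamma>) * ?C (Suc k) - real (Suc k) * ?C k)"
      using mmr_C_recurrence[of \<theta> \<gamma> "Suc k"] \<theta>_pos by (simp add: mult.commute mult.left_commute)
    ultimately show ?case
      using Suc.IH Suc.prems by (simp add: algebra_simps)
  qed
  from this[of "r - 1"] show ?thesis
    using r_ge_1 p_step by (simp add: algebra_simps)
qed

section \<open>Closed forms for the delay, the queue length and the mean\<close>

lemma delay_sums: "(\<lambda>k. p (r + k)) sums (\<alpha> / (1 - \<alpha>) * p (r - 1))"
  using sums_mult[OF geometric_sums[of \<alpha>], of "\<alpha> * p (r - 1)"] \<alpha>_bounds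
  by (simp add: p_geometric mult_ac)

lemma queue_sums: "(\<lambda>k. real k * p (r + k)) sums ((\<alpha> / (1 - \<alpha>))\<^sup>2 * p (r - 1))"
proof -
  \<comment> \<open>The term of index 0 vanishes, so summation starts at 1;
    \<open>p (r + Suc k)\<close> carries \<open>\<alpha> ^ (k + 2)\<close>, whence the factor
    \<open>\<alpha>\<^sup>2\<close>.\<close>
  have "(\<lambda>k. real (Suc k) * \<alpha> ^ k * (\<alpha>\<^sup>2 * p (r - 1))) sums
      (1 / (1 - \<alpha>)\<^sup>2 * (\<alpha>\<^sup>2 * p (r - 1)))"
    using sums_mult2[OF geometric_deriv_sums[of \<alpha>]] \<alpha>_bounds by simp
  then have "(\<lambda>k. real (Suc k) * p (r + Suc k)) sums ((\<alpha> / (1 - \<alpha>))\<^sup>2 * p (r - 1))"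
    by (simp only: p_geometric) (simp add: power2_eq_square mult_ac)
  from sums_Suc[where f="\<lambda>k. real k * p (r + k)", OF this] show ?thesis
    by simp
qed

lemma infsum_delay: "(\<Sum>\<^sub>\<infinity>n\<in>{r..}. p n) = \<alpha> / (1 - \<alpha>) * p (r - 1)"
  by (rule infsumI[OF has_sum_atLeast[OF p_nonneg delay_sums]])

lemma infsum_queue: "(\<Sum>\<^sub>\<infinity>n\<in>{r..}. real (n - r) * p n) = (\<alpha> / (1 - \<alpha>))\<^sup>2 * p (r - 1)"
  by (rule infsumI[OF has_sum_atLeast[where r=r]]) (use queue_sums p_nonneg in auto)

text \<open>The balance equation of state \<open>j\<close>, multiplied by \<open>j\<close> and summed over \<open>j \<le> K\<close>.\<close>

lemma weighted_balance:
  "\<theta> * (real K * p K - (\<Sum>n<K. p n)) + (\<Sum>n\<le>K. real (min n r) * p n)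
    - real K * (real (min (Suc K) r) * p (Suc K)) + \<gamma> * (\<Sum>n\<le>K. real n * p n) = 0"
proof (induction K)
  case (Suc K)
  have "real (min (Suc (Suc K)) r) * p (Suc (Suc K)) =
      (\<theta> + real (min (Suc K) r) + \<gamma>) * p (Suc K) - \<theta> * p K"
    using balance_Suc[of K] by simp
  then have "real (Suc K) * (real (min (Suc (Suc K)) r) * p (Suc (Suc K))) =
      real (Suc K) * ((\<theta> + real (min (Suc K) r) + \<gamma>) * p (Suc K) - \<theta> * p K)"
    by (rule arg_cong)
  also have "\<dots> = (1 + real K) * (\<theta> * p (Suc K) - \<theta> * p K + \<gamma> * p (Suc K)) +
      (1 + real K) * (real (min (Suc K) r) * p (Suc K))"
    by (simp only: of_nat_Suc) (simp add: algebra_simps)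
  finally show ?case
    using Suc.IH by (simp add: algebra_simps)
qed simp

lemma summable_mean: "summable (\<lambda>n. real n * p n)"
proof -
  have "summable (\<lambda>k. real k * p (r + k) + real r * p (r + k))"
    by (intro summable_add summable_mult sums_summable[OF queue_sums] sums_summable[OF delay_sums])
  then have "summable (\<lambda>k. real (k + r) * p (k + r))"
    by (simp add: algebra_simps)
  then show ?thesis
    by (subst (asm) summable_iff_shift)
qed

text \<open>Truncated subtraction kills the terms below \<open>r\<close>, so the queue sum extends
  to all \<open>n\<close> and can be subtracted from the mean.\<close>

lemma excess_sums: "(\<lambda>n. real (n - r) * p n) sums ((\<alpha> / (1 - \<alpha>))\<^sup>2 * p (r - 1))"
proof -
  let ?e = "\<lambda>n. real (n - r) * p n"
  have "(\<lambda>k. ?e (k + r)) sums ((\<alpha> / (1 - \<alpha>))\<^sup>2 * p (r - 1))"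
    using queue_sums by (simp only: add.commute[of r] diff_add_inverse2)
  then have "?e sums ((\<alpha> / (1 - \<alpha>))\<^sup>2 * p (r - 1) + (\<Sum>n<r. ?e n))"
    by (rule sums_iff_shift[THEN iffD1])
  then show ?thesis by simp
qed

text \<open>Let \<open>K\<close> tend to infinity in \<open>weighted_balance\<close>: the boundary
  terms vanish, and \<open>min n r = n - (n - r)\<close> makes the mean number of busy servers
  \<open>?L - ?Q\<close>.\<close>

lemma mean_identity:
  "(1 + \<gamma>) * (\<Sum>n. real n * p n) = \<theta> + (\<alpha> / (1 - \<alpha>))\<^sup>2 * p (r - 1)"
proof -
  let ?L = "\<Sum>n. real n * p n" and ?Q = "(\<alpha> / (1 - \<alpha>))\<^sup>2 * p (r - 1)"
  have mean: "(\<lambda>n. real n * p n) sums ?L"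
    using summable_mean by (rule summable_sums)
  have lim0: "(\<lambda>K. real K * p K) \<longlonglongrightarrow> 0"
    using summable_mean by (rule summable_LIMSEQ_zero)
  have busy: "(\<lambda>n. real (min n r) * p n) sums (?L - ?Q)"
  proof -
    have "real (min n r) * p n = real n * p n - real (n - r) * p n" for n
      by (cases "n \<le> r") (auto simp: of_nat_diff algebra_simps)
    then show ?thesis
      using sums_diff[OF mean excess_sums] by (simp)
  qed
  have "(\<lambda>K. real K * (real (min (Suc K) r) * p (Suc K))) \<longlonglongrightarrow> 0"
  proof (rule Lim_null_comparison)
    show "\<forall>\<^sub>F K in sequentially. norm (real K * (real (min (Suc K) r) * p (Suc K))) \<le>
        real r * (real (Suc K) * p (Suc K))"
    proof (intro always_eventually allI)
      fix K
      have "real K * real (min (Suc K) r) \<le> real (Suc K) * real r"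
        by (intro mult_mono) auto
      then have "(real K * real (min (Suc K) r)) * p (Suc K) \<le> (real (Suc K) * real r) * p (Suc K)"
        by (intro mult_right_mono p_nonneg)
      then show "norm (real K * (real (min (Suc K) r) * p (Suc K))) \<le>
          real r * (real (Suc K) * p (Suc K))"
        using p_nonneg[of "Suc K"] by (simp add: abs_mult mult_ac del: of_nat_Suc)
    qed
    show "(\<lambda>K. real r * (real (Suc K) * p (Suc K))) \<longlonglongrightarrow> 0"
      using tendsto_mult_right_zero[OF LIMSEQ_Suc[OF lim0]] .
  qed
  \<comment> \<open>Sums over \<open>n < K\<close> match \<open>sums_def\<close>, those over
    \<open>n \<le> K\<close> match \<open>sums_def_le\<close>; hence the separate
    unfoldings.\<close>
  then have "(\<lambda>K. \<theta> * (real K * p K - (\<Sum>n<K. p n)) + (\<Sum>n\<le>K. real (min n r) * p n)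
      - real K * (real (min (Suc K) r) * p (Suc K)) + \<gamma> * (\<Sum>n\<le>K. real n * p n)) \<longlonglongrightarrow>
      \<theta> * (0 - 1) + (?L - ?Q) - 0 + \<gamma> * ?L"
    using mean busy p_sums unfolding sums_def_le[where f="\<lambda>n. real n * p n"]
      sums_def_le[where f="\<lambda>n. real (min n r) * p n"] sums_def[where f=p]
    by (intro tendsto_intros lim0)
  then have "\<theta> * (0 - 1) + (?L - ?Q) - 0 + \<gamma> * ?L = 0"
    unfolding weighted_balance by (simp add: LIMSEQ_const_iff)
  then show ?thesis by (simp add: algebra_simps)
qed

text \<open>With \<open>x = \<alpha> / (1 - \<alpha>)\<close> the bracket collapses to
  \<open>- (\<gamma> / (\<gamma> + 1)) * x\<close>, and what remains is \<open>mean_identity\<close>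
  solved for the mean.\<close>

lemma system_formula:
  "(\<Sum>n. real n * p n) = (\<alpha> / (1 - \<alpha>))\<^sup>2 * p (r - 1) + \<theta> / (\<gamma> + 1) +
    (real r - (1 - \<alpha>) / \<alpha> *
      (\<theta> * (\<theta> - real r * \<alpha>) / (\<gamma> * (\<gamma> + 1)) +
       (real r * \<theta> - real r * (real r - 1) * \<alpha>) / (\<gamma> + 1))) * (\<alpha> / (1 - \<alpha>) * p (r - 1))"
proof -
  define u where "u = \<theta> - real r * \<alpha>"
  define x where "x = \<alpha> / (1 - \<alpha>)"
  have x: "x > 0" using \<alpha>_bounds by (simp add: x_def)
  have u: "u = \<gamma> * x"
    using \<alpha>_quadratic \<alpha>_bounds by (simp add: u_def x_def field_simps)
  have \<theta>: "\<theta> = u + real r * \<alpha>" by (simp add: u_def)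
  have \<alpha>: "\<alpha> = x / (1 + x)"
    using \<alpha>_bounds by (simp add: x_def field_simps)
  \<comment> \<open>A rational identity in free variables: \<open>y\<close>, \<open>t\<close>,
    \<open>g\<close>, \<open>a\<close>, \<open>R\<close> stand for \<open>x\<close>,
    \<open>\<theta>\<close>, \<open>\<gamma>\<close>, \<open>\<alpha>\<close>,
    \<open>real r\<close>, and the root equation enters as \<open>t = g * y + R * a\<close>.\<close>
  have "R - 1 / y * (t * (g * y) / (g * (g + 1)) + (R * t - R * (R - 1) * a) / (g + 1)) =
      - (g / (g + 1)) * y"
    if "y > 0" "g > 0" "a = y / (1 + y)" "t = g * y + R * a" for R y t g a :: real
  proof -
    have "t * (g * y) / (g * (g + 1)) = y * (t / (g + 1))"
      using that(2) by (simp add: divide_simps)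
    moreover have "R * t - R * (R - 1) * a = y * (R * (g + a / y))"
      using that(1) by (simp add: that(4) algebra_simps)
    ultimately have "1 / y * (t * (g * y) / (g * (g + 1)) + (R * t - R * (R - 1) * a) / (g + 1)) =
        (t + R * (g + a / y)) / (g + 1)"
      using that(1) by (simp add: add_divide_distrib distrib_left)
    also have "t + R * (g + a / y) = g * y + R * (a * (1 + 1 / y)) + R * g"
      by (simp add: that(4) algebra_simps)
    also have "a * (1 + 1 / y) = 1"
      using that(1) by (simp add: that(3) divide_simps)
    finally have E: "1 / y * (t * (g * y) / (g * (g + 1)) + (R * t - R * (R - 1) * a) / (g + 1)) =
        (g * y + R * 1 + R * g) / (g + 1)" .
    show ?thesis
      unfolding E using that(2) by (simp add: divide_simps) (simp add: algebra_simps)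
  qed
  from this[OF x \<gamma>_pos \<alpha>, of \<theta> "real r"] u
  have bracket: "real r - (1 - \<alpha>) / \<alpha> * (\<theta> * (\<theta> - real r * \<alpha>) / (\<gamma> * (\<gamma> + 1)) +
      (real r * \<theta> - real r * (real r - 1) * \<alpha>) / (\<gamma> + 1)) = - (\<gamma> / (\<gamma> + 1)) * x"
    by (simp add: u_def x_def)
  have "(\<Sum>n. real n * p n) = (\<theta> + x\<^sup>2 * p (r - 1)) / (\<gamma> + 1)"
    using mean_identity \<gamma>_pos by (simp add: x_def field_simps)
  then show ?thesis
    unfolding bracket x_def[symmetric] using \<gamma>_pos
    by (simp add: divide_simps power2_eq_square) (simp add: algebra_simps)
qed

text \<open>\<open>q\<close> equals \<open>r * \<mu> / (r * \<mu> + \<kappa>)\<close>, the Laplace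
  transform at \<kappa> of one service interval, so the sum is that of the total service time
  awaited. Below \<open>r\<close> the truncated exponent \<open>n + 1 - r\<close> is 0, as no
  waiting requires; \<open>n - r + 1\<close> would give 1.\<close>

lemma waiting_sums:
  fixes q :: real
  assumes q: "q = real r / (real r + \<gamma>)"
  shows "(\<lambda>n. p n * q ^ (n + 1 - r)) sums (1 - \<gamma> / \<theta> * ((\<alpha> / (1 - \<alpha>))\<^sup>2 * p (r - 1)))"
proof -
  let ?f = "\<lambda>n. p n * q ^ (n + 1 - r)"
  have q01: "0 < q" "q < 1" using r_pos \<gamma>_pos by (simp_all add: q)
  have \<alpha>q: "0 < \<alpha> * q" "\<alpha> * q < 1"
    using q01 \<alpha>_bounds mult_strict_mono[of \<alpha> 1 q 1] by simp_all
  have "(\<lambda>k. \<alpha> * q * p (r - 1) * (\<alpha> * q) ^ k) sums (\<alpha> * q * p (r - 1) * (1 / (1 - \<alpha> * q)))"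
    using \<alpha>q by (intro sums_mult geometric_sums) simp
  moreover have "?f (k + r) = \<alpha> * q * p (r - 1) * (\<alpha> * q) ^ k" for k
    using p_geometric[of k] by (simp add: add.commute power_mult_distrib)
  ultimately have "(\<lambda>k. ?f (k + r)) sums (\<alpha> * q * p (r - 1) * (1 / (1 - \<alpha> * q)))"
    by (simp only:)
  then have sums: "?f sums (\<alpha> * q * p (r - 1) * (1 / (1 - \<alpha> * q)) + (\<Sum>n<r. ?f n))"
    by (rule sums_iff_shift[THEN iffD1])
  have "(\<lambda>k. p (k + r)) sums (\<alpha> / (1 - \<alpha>) * p (r - 1))"
    using delay_sums by (simp only: add.commute[of r])
  then have "p sums (\<alpha> / (1 - \<alpha>) * p (r - 1) + (\<Sum>n<r. p n))"
    by (rule sums_iff_shift[THEN iffD1])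
  then have "1 = \<alpha> / (1 - \<alpha>) * p (r - 1) + (\<Sum>n<r. p n)"
    by (rule sums_unique2[OF p_sums])
  then have below: "(\<Sum>n<r. p n) = 1 - \<alpha> / (1 - \<alpha>) * p (r - 1)"
    by simp
  have "(\<Sum>n<r. ?f n) = (\<Sum>n<r. p n)"
    by (intro sum.cong) auto
  moreover have "\<alpha> / (1 - \<alpha>) - \<alpha> * q / (1 - \<alpha> * q) = \<gamma> / \<theta> * (\<alpha> / (1 - \<alpha>))\<^sup>2"
  proof -
    \<comment> \<open>Chosen so that \<open>1 - \<alpha> * q = D / (real r + \<gamma>)\<close>; the
      root equation then reads \<open>\<alpha> * D = \<theta> * (1 - \<alpha>)\<close>.\<close>
    define D where "D = real r + \<gamma> - real r * \<alpha>"
    have \<alpha>D: "\<alpha> * D = \<theta> * (1 - \<alpha>)"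
      using \<alpha>_quadratic by (simp add: D_def algebra_simps)
    have "\<alpha> * D > 0"
      unfolding \<alpha>D using \<theta>_pos \<alpha>_bounds by simp
    then have D: "D > 0"
      using \<alpha>_bounds(1) by (rule zero_less_mult_pos)
    have "1 - \<alpha> * q = D / (real r + \<gamma>)"
      using r_pos \<gamma>_pos by (simp add: q D_def field_simps)
    then have "\<alpha> * q / (1 - \<alpha> * q) = \<alpha> * real r / D"
      using r_pos \<gamma>_pos by (simp add: q)
    then have "\<alpha> / (1 - \<alpha>) - \<alpha> * q / (1 - \<alpha> * q) = \<alpha> / (1 - \<alpha>) - \<alpha> * real r / D"
      by (rule arg_cong)
    also have "\<dots> = \<alpha> * (D - real r * (1 - \<alpha>)) / ((1 - \<alpha>) * D)"
      using D \<alpha>_bounds by (simp add: divide_simps) (simp add: algebra_simps)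
    also have "D - real r * (1 - \<alpha>) = \<gamma>"
      by (simp add: D_def algebra_simps)
    also have "\<alpha> * \<gamma> / ((1 - \<alpha>) * D) = \<alpha> * \<alpha> * \<gamma> / ((1 - \<alpha>) * (\<alpha> * D))"
      using \<alpha>_bounds D by simp
    also have "\<dots> = \<gamma> / \<theta> * (\<alpha> / (1 - \<alpha>))\<^sup>2"
      unfolding \<alpha>D by (simp add: power2_eq_square mult_ac)
    finally show ?thesis .
  qed
  then have diff: "\<alpha> * q / (1 - \<alpha> * q) = \<alpha> / (1 - \<alpha>) - \<gamma> / \<theta> * (\<alpha> / (1 - \<alpha>))\<^sup>2"
    by simp
  have "\<alpha> * q * p (r - 1) * (1 / (1 - \<alpha> * q)) =
      (\<alpha> / (1 - \<alpha>) - \<gamma> / \<theta> * (\<alpha> / (1 - \<alpha>))\<^sup>2) * p (r - 1)"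
    unfolding diff[symmetric] by simp
  ultimately show ?thesis
    using sums below by (simp add: left_diff_distrib mult.assoc)
qed

end

section \<open>Waiting time\<close>

lemma (in prob_space)
  assumes D: "distributed M lborel X (exponential_density l)" and l: "l > 0" and c: "c > 0"
  shows expectation_exp_exponential: "expectation (\<lambda>\<omega>. exp (- (c * X \<omega>))) = l / (l + c)"
    and integrable_exp_exponential: "integrable M (\<lambda>\<omega>. exp (- (c * X \<omega>)))"
proof -
  have lc: "l + c > 0" using l c by simp
  interpret E: prob_space "density lborel (exponential_density (l + c))"
    by (rule prob_space_exponential_density[OF lc])
  have "(\<integral>\<^sup>+x. ennreal (exponential_density (l + c) x) \<partial>lborel) = ennreal 1"
    using E.emeasure_space_1 by (simp add: emeasure_density)
  then have *: "has_bochner_integral lborel (exponential_density (l + c)) 1"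
    using lc by (intro has_bochner_integral_nn_integral) (auto simp: exponential_density_def)
  \<comment> \<open>Exponential tilting: the weight \<open>exp (- (c * x))\<close> turns the density
    of rate \<open>l\<close> into a multiple of the density of rate \<open>l + c\<close>, whose
    integral is 1.\<close>
  have "exp (- x * (l + c)) = exp (- x * l) * exp (- (c * x))" for x
    by (simp add: exp_add[symmetric] algebra_simps)
  then have eq: "exponential_density l x * exp (- (c * x)) = l / (l + c) * exponential_density (l + c) x" for x
    using lc by (simp add: exponential_density_def)
  have **: "has_bochner_integral lborel (\<lambda>x. exponential_density l x * exp (- (c * x))) (l / (l + c) * 1)"
    unfolding eq by (rule has_bochner_integral_mult_right[OF *])
  have nonneg: "0 \<le> exponential_density l x" for x
    using l by (simp add: exponential_density_def)
  show "expectation (\<lambda>\<omega>. exp (- (c * X \<omega>))) = l / (l + c)"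
    using distributed_integral[OF D, of "\<lambda>x. exp (- (c * x))"] nonneg ** 
    by (simp add: has_bochner_integral_iff)
  show "integrable M (\<lambda>\<omega>. exp (- (c * X \<omega>)))"
    using distributed_integrable[OF D, of "\<lambda>x. exp (- (c * x))"] nonneg **
    by (simp add: has_bochner_integral_iff)
qed

lemma (in prob_space) AE_exponential_pos:
  assumes D: "distributed M lborel X (exponential_density l)" and l: "l > 0"
  shows "AE \<omega> in M. 0 < X \<omega>"
proof -
  have X[measurable]: "random_variable borel X"
    using distributed_measurable[OF D] by simp
  have "\<P>(\<omega> in M. X \<omega> \<le> 0) = 0"
    using exponential_distributedD_le[OF D order_refl l] by simp
  then have "AE \<omega> in M. \<not> X \<omega> \<le> 0"
    by (subst (asm) prob_Collect_eq_0) auto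
  then show ?thesis by eventually_elim auto
qed

text \<open>
  Both sides equal \<open>\<integral>\<^sub>0\<^sup>\<infinity> P(X > t) exp (- c t) dt\<close>, by Fubini in either order.
\<close>

lemma (in prob_space) expectation_min_exponential:
  assumes indep: "indep_var borel X borel R"
    and R: "distributed M lborel R (exponential_density c)" and c: "c > 0"
    and X_nonneg: "AE \<omega> in M. 0 \<le> X \<omega>"
  shows "expectation (\<lambda>\<omega>. min (X \<omega>) (R \<omega>)) = (1 - expectation (\<lambda>\<omega>. exp (- (c * X \<omega>)))) / c"
proof -
  note [measurable] = indep_var_rv1[OF indep] indep_var_rv2[OF indep]
  interpret pair_sigma_finite M lborel ..
  have "(\<integral>\<^sup>+\<omega>. ennreal (min (X \<omega>) (R \<omega>)) \<partial>M) =
      (\<integral>\<^sup>+\<omega>. (\<integral>\<^sup>+t. indicator {0..} t * (indicator {t<..} (X \<omega>) * indicator {t<..} (R \<omega>)) \<partial>lborel) \<partial>M)"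
  proof (rule nn_integral_cong)
    fix \<omega>
    \<comment> \<open>Layer-cake representation; a negative minimum gives an empty interval, in
      accordance with the truncation by \<open>ennreal\<close>.\<close>
    have "(\<integral>\<^sup>+t. indicator {0..} t * (indicator {t<..} (X \<omega>) * indicator {t<..} (R \<omega>)) \<partial>lborel) =
        (\<integral>\<^sup>+t. indicator {0..<min (X \<omega>) (R \<omega>)} t \<partial>lborel)"
      by (intro nn_integral_cong) (auto simp: indicator_def)
    also have "\<dots> = ennreal (min (X \<omega>) (R \<omega>))"
    proof -
      have "emeasure lborel {0..<u} = ennreal u" for u :: real
        by (cases "0 \<le> u") (auto simp: ennreal_neg)
      then show ?thesis by simp
    qed
    finally show "ennreal (min (X \<omega>) (R \<omega>)) =
        (\<integral>\<^sup>+t. indicator {0..} t * (indicator {t<..} (X \<omega>) * indicator {t<..} (R \<omega>)) \<partial>lborel)" ..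
  qed
  also have "\<dots> =
      (\<integral>\<^sup>+t. (\<integral>\<^sup>+\<omega>. indicator {0..} t * (indicator {t<..} (X \<omega>) * indicator {t<..} (R \<omega>)) \<partial>M) \<partial>lborel)"
    by (rule Fubini'[symmetric]) (simp add: indicator_def)
  also have "\<dots> =
      (\<integral>\<^sup>+t. (\<integral>\<^sup>+\<omega>. indicator {0..} t * (indicator {t<..} (X \<omega>) * ennreal (exp (- (c * t)))) \<partial>M) \<partial>lborel)"
  proof (rule nn_integral_cong)
    fix t :: real
    show "(\<integral>\<^sup>+\<omega>. indicator {0..} t * (indicator {t<..} (X \<omega>) * indicator {t<..} (R \<omega>)) \<partial>M) =
        (\<integral>\<^sup>+\<omega>. indicator {0..} t * (indicator {t<..} (X \<omega>) * ennreal (exp (- (c * t)))) \<partial>M)"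
    proof (cases "t \<ge> 0")
      case True
      \<comment> \<open>Independence enters here, at fixed \<open>t\<close>; \<open>R\<close>
        survives only through its tail \<open>exp (- (c * t))\<close>, valid for
        \<open>t \<ge> 0\<close>.\<close>
      have "(\<integral>\<^sup>+\<omega>. indicator {t<..} (X \<omega>) * indicator {t<..} (R \<omega>) \<partial>M) =
          (\<integral>\<^sup>+\<omega>. indicator ((\<lambda>x. (X x, R x)) -` ({t<..} \<times> {t<..}) \<inter> space M) \<omega> \<partial>M)"
        by (intro nn_integral_cong) (auto simp: indicator_def)
      also have "\<dots> = ennreal (prob ((\<lambda>x. (X x, R x)) -` ({t<..} \<times> {t<..}) \<inter> space M))"
        by (subst nn_integral_indicator) (auto simp: emeasure_eq_measure)
      also have "\<dots> = ennreal (prob (X -` {t<..} \<inter> space M) * prob (R -` {t<..} \<inter> space M))"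
        by (subst indep_varD[OF indep]) auto
      also have "prob (R -` {t<..} \<inter> space M) = exp (- (c * t))"
        using exponential_distributedD_gt[OF R True c]
        by (simp add: vimage_def Int_def conj_commute mult.commute)
      also have "ennreal (prob (X -` {t<..} \<inter> space M) * exp (- (c * t))) =
          (\<integral>\<^sup>+\<omega>. indicator (X -` {t<..} \<inter> space M) \<omega> * ennreal (exp (- (c * t))) \<partial>M)"
        by (subst nn_integral_multc) (auto simp: emeasure_eq_measure ennreal_mult)
      also have "\<dots> = (\<integral>\<^sup>+\<omega>. indicator {t<..} (X \<omega>) * ennreal (exp (- (c * t))) \<partial>M)"
        by (intro nn_integral_cong) (auto simp: indicator_def)
      finally show ?thesis using True by simp
    qed simp
  qed
  also have "\<dots> =
      (\<integral>\<^sup>+\<omega>. (\<integral>\<^sup>+t. indicator {0..} t * (indicator {t<..} (X \<omega>) * ennreal (exp (- (c * t)))) \<partial>lborel) \<partial>M)"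
    by (rule Fubini') (simp add: indicator_def)
  also have "\<dots> = (\<integral>\<^sup>+\<omega>. ennreal ((1 - exp (- (c * X \<omega>))) / c) \<partial>M)"
  proof -
    have inner: "(\<integral>\<^sup>+t. indicator {0..} t * (indicator {t<..} (X \<omega>) * ennreal (exp (- (c * t)))) \<partial>lborel) =
        ennreal ((1 - exp (- (c * X \<omega>))) / c)" if X: "0 \<le> X \<omega>" for \<omega>
    proof -
      \<comment> \<open>The closed interval suits the fundamental theorem of calculus and differs
        from the half-open one by the null set \<open>{X \<omega>}\<close>.\<close>
      have "(\<integral>\<^sup>+t. indicator {0..} t * (indicator {t<..} (X \<omega>) * ennreal (exp (- (c * t)))) \<partial>lborel) =
          (\<integral>\<^sup>+t. ennreal (exp (- (c * t))) * indicator {0..X \<omega>} t \<partial>lborel)"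
        by (intro nn_integral_cong_AE, use AE_lborel_singleton[of "X \<omega>"] in eventually_elim)
           (auto simp: indicator_def)
      also have "\<dots> = ennreal (- exp (- (c * X \<omega>)) / c - - exp (- (c * 0)) / c)"
        using c X by (intro nn_integral_FTC_Icc) (auto intro!: derivative_eq_intros)
      finally show ?thesis
        by (simp add: diff_divide_distrib)
    qed
    show ?thesis
      by (rule nn_integral_cong_AE, use X_nonneg in eventually_elim) (rule inner)
  qed
  finally have nn: "(\<integral>\<^sup>+\<omega>. ennreal (min (X \<omega>) (R \<omega>)) \<partial>M) =
      (\<integral>\<^sup>+\<omega>. ennreal ((1 - exp (- (c * X \<omega>))) / c) \<partial>M)" .
  have min_nonneg: "AE \<omega> in M. 0 \<le> min (X \<omega>) (R \<omega>)"
    using X_nonneg AE_exponential_pos[OF R c] by eventually_elim auto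
  have exp_nonneg: "AE \<omega> in M. 0 \<le> (1 - exp (- (c * X \<omega>))) / c"
    using X_nonneg by eventually_elim (use c in auto)
  have int: "integrable M (\<lambda>\<omega>. exp (- (c * X \<omega>)))"
    by (rule integrable_const_bound[where B=1], use X_nonneg in eventually_elim) (use c in auto)
  have "expectation (\<lambda>\<omega>. min (X \<omega>) (R \<omega>)) = expectation (\<lambda>\<omega>. (1 - exp (- (c * X \<omega>))) / c)"
    using integral_eq_nn_integral[OF _ min_nonneg] integral_eq_nn_integral[OF _ exp_nonneg]
    by (simp add: nn del: integral_divide_zero)
  also have "\<dots> = (1 - expectation (\<lambda>\<omega>. exp (- (c * X \<omega>)))) / c"
    using int by (simp add: prob_space)
  finally show ?thesis .
qed

text \<open>\<open>expectation_min_exponential\<close> leaves the Laplace transform of the total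
  service time \<open>X\<close>; splitting by the value of \<open>N\<close> makes it a series whose
  terms factor by independence.\<close>

lemma arrival_model_expectation_waiting_time:
  assumes model: "arrival_model M r \<mu> \<kappa> \<pi> N S R"
    and r: "r \<ge> 1" and \<mu>: "\<mu> > 0" and \<kappa>: "\<kappa> > 0"
    and V: "(\<lambda>n. pmf \<pi> n * (real r * \<mu> / (real r * \<mu> + \<kappa>)) ^ (n + 1 - r)) sums V"
  shows "prob_space.expectation M (waiting_time r N S R) = (1 - V) / \<kappa>"
proof -
  interpret prob_space M
    using model by (simp add: arrival_model_def)
  define F where "F = case_nat (\<lambda>\<omega>. real (N \<omega>)) (case_nat R S)"
  have N[measurable]: "N \<in> measurable M (count_space UNIV)"
    and N_distr: "distr M (count_space UNIV) N = measure_pmf \<pi>"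
    and S_distr: "\<And>k. distributed M lborel (S k) (exponential_density (real r * \<mu>))"
    and R_distr: "distributed M lborel R (exponential_density \<kappa>)"
    and indep: "indep_vars (\<lambda>_. borel) F UNIV"
    using model by (simp_all add: arrival_model_def F_def)
  have [measurable]: "random_variable borel (S k)" for k
    using distributed_measurable[OF S_distr[of k]] by simp
  have [measurable]: "random_variable borel R"
    using distributed_measurable[OF R_distr] by simp
  have F: "F 0 \<omega> = real (N \<omega>)" "F 1 \<omega> = R \<omega>" "F (Suc (Suc k)) \<omega> = S k \<omega>" for \<omega> k
    by (simp_all add: F_def)
  have r\<mu>: "real r * \<mu> > 0" using r \<mu> by simp
  define q where "q = real r * \<mu> / (real r * \<mu> + \<kappa>)"
  \<comment> \<open>Unlike \<open>N \<omega> - r + 1\<close>, this count is 0 for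
    \<open>N \<omega> < r\<close>, so \<open>min (X \<omega>) (R \<omega>)\<close> is the waiting
    time in both cases wherever \<open>R \<omega> > 0\<close>.\<close>
  define X where "X \<omega> = (\<Sum>k<N \<omega> + 1 - r. S k \<omega>)" for \<omega>
  have S_pos: "AE \<omega> in M. \<forall>k. 0 < S k \<omega>"
    using AE_exponential_pos[OF S_distr r\<mu>] by (simp add: AE_all_countable)
  have X_nonneg: "AE \<omega> in M. 0 \<le> X \<omega>"
    using S_pos by eventually_elim (auto simp: X_def less_imp_le intro!: sum_nonneg)
  have XR: "indep_var borel X borel R"
  proof -
    \<comment> \<open>\<open>R\<close> has index 1, and \<open>X\<close> depends only on the other
      indices; disjoint index sets give independence. The floor recovers \<open>N\<close> from its
      real copy.\<close>
    let ?g = "\<lambda>f. \<Sum>k<nat \<lfloor>f 0\<rfloor> + 1 - r. f (Suc (Suc k)) :: real"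
    let ?A = "- {1 :: nat}" and ?B = "{1 :: nat}"
    have count: "(\<lambda>f. nat \<lfloor>f 0\<rfloor> + 1 - r) \<in> measurable (PiM ?A (\<lambda>_. borel :: real measure)) (count_space UNIV)"
      by measurable
    \<comment> \<open>The number of summands varies with the argument, so measurability is checked
      for each fixed count.\<close>
    have "?g \<in> borel_measurable (PiM ?A (\<lambda>_. borel))"
      by (rule measurable_compose_countable[OF _ count]) measurable
    moreover have "(\<lambda>f. f 1) \<in> measurable (PiM ?B (\<lambda>_. borel :: real measure)) borel"
      by measurable
    ultimately have "indep_var borel (?g \<circ> (\<lambda>\<omega>. restrict (\<lambda>i. F i \<omega>) ?A))
        borel ((\<lambda>f. f 1) \<circ> (\<lambda>\<omega>. restrict (\<lambda>i. F i \<omega>) ?B))"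
      by (intro indep_var_compose[OF indep_var_restrict[OF indep]]) auto
    moreover have "?g \<circ> (\<lambda>\<omega>. restrict (\<lambda>i. F i \<omega>) ?A) = X"
      by (simp add: fun_eq_iff X_def F)
    moreover have "(\<lambda>f. f 1) \<circ> (\<lambda>\<omega>. restrict (\<lambda>i. F i \<omega>) ?B) = R"
      by (simp add: fun_eq_iff F del: One_nat_def)
    ultimately show ?thesis by simp
  qed
  note [measurable] = indep_var_rv1[OF XR]
  have W: "AE \<omega> in M. waiting_time r N S R \<omega> = min (X \<omega>) (R \<omega>)"
    using AE_exponential_pos[OF R_distr \<kappa>]
    by eventually_elim (auto simp: waiting_time_def X_def Suc_diff_le not_less)
  have [measurable]: "random_variable borel (waiting_time r N S R)"
  proof -
    have [measurable]: "random_variable borel (\<lambda>\<omega>. \<Sum>k<N \<omega> - r + 1. S k \<omega>)"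
      by (rule measurable_compose_countable[where g="\<lambda>\<omega>. N \<omega> - r + 1"]) measurable
    show ?thesis
      unfolding waiting_time_def[abs_def] by measurable
  qed
  have [measurable]: "random_variable borel (\<lambda>\<omega>. indicator {n} (N \<omega>) :: real)" for n
    by (rule measurable_compose[OF N]) simp
  have summand: "(\<integral>\<^sup>+\<omega>. ennreal (indicator {n} (N \<omega>) * exp (- (\<kappa> * X \<omega>))) \<partial>M) =
      ennreal (pmf \<pi> n * q ^ (n + 1 - r))" for n
  proof -
    define m where "m = n + 1 - r"
    \<comment> \<open>Index 0 belongs to \<open>N\<close> and \<open>k + 2\<close> to
      \<open>S k\<close>; \<open>Y\<close> turns the integrand into a product over \<open>J\<close>
      of functions of independent coordinates.\<close>
    define J where "J = insert 0 ((\<lambda>k. Suc (Suc k)) ` {..<m})"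
    define Y where "Y i x = (if i = 0 then indicator {real n} x else exp (- (\<kappa> * x)))" for i :: nat and x :: real
    have Y_indep: "indep_vars (\<lambda>_. borel) (\<lambda>i \<omega>. Y i (F i \<omega>)) J"
      by (rule indep_vars_compose2[OF indep_vars_subset[OF indep]]) (auto simp: Y_def[abs_def])
    have Y_0: "Y 0 (F 0 \<omega>) = indicator {n} (N \<omega>)" for \<omega>
      by (simp add: Y_def F indicator_def)
    have Y_S: "Y (Suc (Suc k)) (F (Suc (Suc k)) \<omega>) = exp (- (\<kappa> * S k \<omega>))" for k \<omega>
      by (simp add: Y_def F)
    have Y_int: "integrable M (\<lambda>\<omega>. Y i (F i \<omega>))" if "i \<in> J" for i
    proof -
      have "integrable M (\<lambda>\<omega>. indicator {n} (N \<omega>) :: real)"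
        by (rule integrable_const_bound[where B=1]) auto
      then show ?thesis
        using that integrable_exp_exponential[OF S_distr r\<mu> \<kappa>]
        by (auto simp: J_def Y_0 Y_S)
    qed
    have J: "finite J" by (simp add: J_def)
    have split: "(\<Prod>i\<in>J. h i) = h 0 * (\<Prod>k<m. h (Suc (Suc k)))" for h :: "nat \<Rightarrow> real"
    proof -
      have "inj_on (\<lambda>k. Suc (Suc k)) {..<m}" by (simp add: inj_on_def)
      then show ?thesis
        unfolding J_def by (subst prod.insert) (auto simp: prod.reindex)
    qed
    \<comment> \<open>On \<open>N \<omega> = n\<close> the sum in \<open>X\<close> has exactly
      \<open>m\<close> terms; elsewhere both sides are 0.\<close>
    have eq: "indicator {n} (N \<omega>) * exp (- (\<kappa> * X \<omega>)) = (\<Prod>i\<in>J. Y i (F i \<omega>))" for \<omega>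
      by (cases "N \<omega> = n")
         (simp_all add: split Y_0 Y_S X_def m_def sum_distrib_left sum_negf[symmetric] exp_sum del: sum_negf)
    have "expectation (\<lambda>\<omega>. indicator {n} (N \<omega>) :: real) = pmf \<pi> n"
    proof -
      have "expectation (\<lambda>\<omega>. indicator {n} (N \<omega>) :: real) =
          integral\<^sup>L (distr M (count_space UNIV) N) (indicator {n})"
        by (subst integral_distr) auto
      then show ?thesis by (simp add: N_distr measure_pmf_single)
    qed
    then have "expectation (\<lambda>\<omega>. \<Prod>i\<in>J. Y i (F i \<omega>)) = pmf \<pi> n * q ^ m"
      using indep_vars_lebesgue_integral[OF J Y_indep Y_int]
        expectation_exp_exponential[OF S_distr r\<mu> \<kappa>]
      by (simp add: split Y_0 Y_S q_def)
    moreover have "integrable M (\<lambda>\<omega>. \<Prod>i\<in>J. Y i (F i \<omega>))"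
      by (rule indep_vars_integrable[OF J Y_indep Y_int])
    ultimately show ?thesis
      unfolding m_def[symmetric] eq
      by (subst nn_integral_eq_integral) (auto simp: Y_def prod_nonneg)
  qed
  \<comment> \<open>Partition by the value of \<open>N\<close>; nonnegativity permits exchanging sum
    and integral.\<close>
  have "(\<integral>\<^sup>+\<omega>. ennreal (exp (- (\<kappa> * X \<omega>))) \<partial>M) =
      (\<integral>\<^sup>+\<omega>. (\<Sum>n. ennreal (indicator {n} (N \<omega>) * exp (- (\<kappa> * X \<omega>)))) \<partial>M)"
  proof (rule nn_integral_cong)
    fix \<omega>
    have "(\<Sum>n. ennreal (indicator {n} (N \<omega>) * exp (- (\<kappa> * X \<omega>)))) =
        (\<Sum>n\<in>{N \<omega>}. ennreal (indicator {n} (N \<omega>) * exp (- (\<kappa> * X \<omega>))))"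
      by (rule suminf_finite) (auto simp: indicator_def)
    then show "ennreal (exp (- (\<kappa> * X \<omega>))) =
        (\<Sum>n. ennreal (indicator {n} (N \<omega>) * exp (- (\<kappa> * X \<omega>))))"
      by simp
  qed
  also have "\<dots> = (\<Sum>n. ennreal (pmf \<pi> n * q ^ (n + 1 - r)))"
    by (subst nn_integral_suminf) (simp_all add: summand)
  also have "\<dots> = ennreal V"
    using V r\<mu> \<kappa> by (intro suminf_ennreal_eq) (auto simp: q_def)
  finally have "(\<integral>\<^sup>+\<omega>. ennreal (exp (- (\<kappa> * X \<omega>))) \<partial>M) = ennreal V" .
  moreover have "V \<ge> 0"
    by (rule sums_le[OF _ sums_zero V]) (use r\<mu> \<kappa> in auto)
  ultimately have "expectation (\<lambda>\<omega>. exp (- (\<kappa> * X \<omega>))) = V"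
    by (simp add: integral_eq_nn_integral)
  then have "expectation (\<lambda>\<omega>. min (X \<omega>) (R \<omega>)) = (1 - V) / \<kappa>"
    using expectation_min_exponential[OF XR R_distr \<kappa> X_nonneg] by simp
  moreover have "expectation (waiting_time r N S R) = expectation (\<lambda>\<omega>. min (X \<omega>) (R \<omega>))"
    by (rule integral_cong_AE) (use W in auto)
  ultimately show ?thesis by simp
qed

theorem mainTheorem9:
  fixes r :: nat and lam \<mu> \<kappa> \<theta> \<gamma> \<alpha> :: real and C :: "nat \<Rightarrow> real"
    and P :: "real \<Rightarrow> nat \<Rightarrow> nat pmf" and \<pi> :: "nat pmf"
    and M :: "'w measure" and N :: "'w \<Rightarrow> nat" and S :: "nat \<Rightarrow> 'w \<Rightarrow> real" and R :: "'w \<Rightarrow> real"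
  assumes "r \<ge> 1" and "lam > 0" and "\<mu> > 0" and "\<kappa> > 0"
    and "\<theta> = lam / \<mu>" and "\<gamma> = \<kappa> / \<mu>"
    and "\<alpha> = mmr_alpha r \<theta> \<gamma>" and "C = mmr_C \<theta> \<gamma>"
    and "ctmc_with_rates (mmr_reset_rate r lam \<mu> \<kappa>) P"
    and "stationary_distribution P \<pi>"
    and "arrival_model M r \<mu> \<kappa> \<pi> N S R"
  shows "P_delay r \<pi> = \<alpha> / (1 - \<alpha>) * pmf \<pi> (r - 1) \<and>
    \<alpha> / (1 - \<alpha>) * pmf \<pi> (r - 1) =
      \<alpha> / (1 - \<alpha>) * (\<gamma> / (\<theta> * C r - real r * \<alpha> * C (r - 1))) \<and>
    L_queue r \<pi> = \<alpha> / (1 - \<alpha>) * P_delay r \<pi> \<and>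
    L_system \<pi> = L_queue r \<pi> + \<theta> / (\<gamma> + 1) +
      (real r - (1 - \<alpha>) / \<alpha> *
        (\<theta> * (\<theta> - real r * \<alpha>) / (\<gamma> * (\<gamma> + 1)) +
         (real r * \<theta> - real r * (real r - 1) * \<alpha>) / (\<gamma> + 1))) * P_delay r \<pi> \<and>
    prob_space.expectation M (waiting_time r N S R) = 1 / lam * L_queue r \<pi> \<and>
    1 / lam * L_queue r \<pi> = \<alpha> / (lam * (1 - \<alpha>)) * P_delay r \<pi>"
proof -
  note pos = assms(1-4) and \<theta> = assms(5) and \<gamma> = assms(6) and ctmc = assms(9) and stat = assms(10)
  interpret B: mmr_reset_balance r \<theta> \<gamma> "pmf \<pi>"
  proof
    show "(\<theta> + \<gamma>) * pmf \<pi> 0 = pmf \<pi> 1 + \<gamma>"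
      using mmr_reset_balance_0[OF ctmc stat pos(3,4,1)] pos(3) by (simp add: \<theta> \<gamma> field_simps)
    show "(\<theta> + real (min (Suc k) r) + \<gamma>) * pmf \<pi> (Suc k) =
        \<theta> * pmf \<pi> k + real (min (Suc (Suc k)) r) * pmf \<pi> (Suc (Suc k))" for k
    proof -
      have "\<mu> * ((\<theta> + real (min (Suc k) r) + \<gamma>) * pmf \<pi> (Suc k)) =
          (lam + real (min (Suc k) r) * \<mu> + \<kappa>) * pmf \<pi> (Suc k)"
        using pos(3) unfolding \<theta> \<gamma> by (simp add: field_simps del: of_nat_min)
      also have "\<dots> = \<mu> * (\<theta> * pmf \<pi> k + real (min (Suc (Suc k)) r) * pmf \<pi> (Suc (Suc k)))"
        unfolding mmr_reset_balance_Suc[OF ctmc stat pos(3,4)] \<theta>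
        using pos(3) by (simp add: field_simps)
      finally show ?thesis using pos(3) by simp
    qed
  qed (use pos in \<open>simp_all add: \<theta> \<gamma> pmf_nat_sums\<close>)
  have \<alpha>: "B.\<alpha> = \<alpha>" by (simp add: B.\<alpha>_def assms(7))
  have delay: "P_delay r \<pi> = \<alpha> / (1 - \<alpha>) * pmf \<pi> (r - 1)"
    using B.infsum_delay by (simp add: P_delay_def \<alpha>)
  have "pmf \<pi> (r - 1) * (\<theta> * C r - real r * \<alpha> * C (r - 1)) = \<gamma>"
    using B.p_r_minus_1 by (simp add: \<alpha> assms(8))
  \<comment> \<open>The denominator is nonzero because its product with
    \<open>pmf \<pi> (r - 1)\<close> is \<open>\<gamma> > 0\<close>.\<close>
  then have prev: "pmf \<pi> (r - 1) = \<gamma> / (\<theta> * C r - real r * \<alpha> * C (r - 1))"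
    using B.\<gamma>_pos by (metis less_irrefl mult_zero_right nonzero_eq_divide_eq)
  have queue: "L_queue r \<pi> = (\<alpha> / (1 - \<alpha>))\<^sup>2 * pmf \<pi> (r - 1)"
    using B.infsum_queue by (simp add: L_queue_def \<alpha>)
  have queue_delay: "L_queue r \<pi> = \<alpha> / (1 - \<alpha>) * P_delay r \<pi>"
    by (simp add: queue delay power2_eq_square)
  have "L_system \<pi> = (\<Sum>n. real n * pmf \<pi> n)"
    unfolding L_system_def
    by (intro infsumI sums_nonneg_imp_has_sum summable_sums B.summable_mean) simp
  then have system: "L_system \<pi> = L_queue r \<pi> + \<theta> / (\<gamma> + 1) +
      (real r - (1 - \<alpha>) / \<alpha> *
        (\<theta> * (\<theta> - real r * \<alpha>) / (\<gamma> * (\<gamma> + 1)) +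
         (real r * \<theta> - real r * (real r - 1) * \<alpha>) / (\<gamma> + 1))) * P_delay r \<pi>"
    using B.system_formula unfolding \<alpha> queue[symmetric] delay[symmetric] by (rule trans)
  have "real r * \<mu> / (real r * \<mu> + \<kappa>) = real r / (real r + \<gamma>)"
    using pos by (simp add: \<gamma> field_simps)
  from B.waiting_sums[OF this]
  have "(\<lambda>n. pmf \<pi> n * (real r * \<mu> / (real r * \<mu> + \<kappa>)) ^ (n + 1 - r)) sums
      (1 - \<gamma> / \<theta> * L_queue r \<pi>)"
    unfolding \<alpha> queue[symmetric] .
  \<comment> \<open>Since \<open>\<gamma> / \<theta> = \<kappa> / lam\<close>, dividing
    \<open>\<gamma> / \<theta> * L_queue r \<pi>\<close> by \<kappa> gives Little's law.\<close>
  from arrival_model_expectation_waiting_time[OF assms(11) pos(1,3,4) this]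
  have waiting: "prob_space.expectation M (waiting_time r N S R) = 1 / lam * L_queue r \<pi>"
    using pos by (simp add: \<theta> \<gamma>)
  show ?thesis
  proof (intro conjI)
    show "1 / lam * L_queue r \<pi> = \<alpha> / (lam * (1 - \<alpha>)) * P_delay r \<pi>"
      by (simp add: queue_delay)
  qed (use delay prev queue_delay system waiting in simp_all)
qed

end
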